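(* Let $n\ge1$ and let $\mathrm{dec}_n=n(n-1)\cdots1$. The map $\Psi_{\mathrm{Sub}\to\mathrm{PF}}$ restricts to a bijection from the set $\mathrm{NonCross}_n$ of non-crossing matchings on $[n]$ to the fibre $\mathcal{O}^{-1}_{\mathrm{MVP}_n}(\mathrm{dec}_n)$.
   Context: $[n]=\{1,\dots,n\}$. In the MVP parking process for a preference $p\in[n]^n$, cars $1,\dots,n$ enter in order a one-way street with spots $1,\dots,n$; car $i$ parks in spot $p_i$, and if $p_i$ was occupied by an earlier car $j$, car $j$ is bumped and parks in the first unoccupied spot $k>p_i$ (bumped cars do not bump others). $p$ is an MVP parking function if all cars park. The outcome $\mathcal{O}_{\mathrm{MVP}_n}(p)$ is the permutation $\pi$ with $\pi_i$ the car in spot $i$ at the end, and $\mathcal{O}^{-1}_{\mathrm{MVP}_n}(\pi)$ is the set of MVP parking functions with outcome $\pi$. An arc diagram on $[n]$ is a set of pairs $(j,i)$ with $1\le j<i\le n$. For an arc diagram $\Delta$ in which each $i$ has at most one $j$ with $(j,i)\in\Delta$, $\Psi_{\mathrm{Sub}\to\mathrm{PF}}(\Delta)$ is the preference $p$ defined by: for each $i\in[n]$, $p_{n+1-i}=j$ if $(j,i)\in\Delta$, and $p_{n+1-i}=i$ if no such $j$ exists. A non-crossing matching is an arc diagram $\Delta$ such that every vertex of $[n]$ lies in at most one arc of $\Delta$, and there are no $i<j<k<\ell$ with $(i,k),(j,\ell)\in\Delta$. *)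

theory Defs
  imports "HOL-Library.FuncSet" "HOL-Combinatorics.Permutations"
begin

definition preferences :: "nat \<Rightarrow> (nat \<Rightarrow> nat) set" where
  "preferences n = {1..n} \<rightarrow>\<^sub>E {1..n}"

text \<open>A street maps each spot to the car occupying it, if any. A bumped car that finds no
  unoccupied spot further down leaves the street.\<close>

definition mvp_park :: "nat \<Rightarrow> (nat \<Rightarrow> nat) \<Rightarrow> nat \<Rightarrow> (nat \<rightharpoonup> nat) \<Rightarrow> (nat \<rightharpoonup> nat)" where
  "mvp_park n p i s =
     (case s (p i) of
        None \<Rightarrow> s(p i \<mapsto> i)
      | Some j \<Rightarrow>
          (if \<exists>k. p i < k \<and> k \<le> n \<and> s k = None
           then s(p i \<mapsto> i, (LEAST k. p i < k \<and> k \<le> n \<and> s k = None) \<mapsto> j)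
           else s(p i \<mapsto> i)))"

fun mvp_street :: "nat \<Rightarrow> (nat \<Rightarrow> nat) \<Rightarrow> nat \<Rightarrow> (nat \<rightharpoonup> nat)" where
  "mvp_street n p 0 = Map.empty"
| "mvp_street n p (Suc i) = mvp_park n p (Suc i) (mvp_street n p i)"

definition MVP_PF :: "nat \<Rightarrow> (nat \<Rightarrow> nat) set" where
  "MVP_PF n = {p \<in> preferences n. \<forall>i\<in>{1..n}. \<exists>k\<in>{1..n}. mvp_street n p n k = Some i}"

text \<open>Permutations of \<open>{1..n}\<close> follow the convention of \<open>permutes\<close>: identity outside \<open>{1..n}\<close>.
  The outcome is meaningful for MVP parking functions only.\<close>

definition mvp_outcome :: "nat \<Rightarrow> (nat \<Rightarrow> nat) \<Rightarrow> (nat \<Rightarrow> nat)" where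
  "mvp_outcome n p = (\<lambda>k. if k \<in> {1..n} then the (mvp_street n p n k) else k)"

definition mvp_fibre :: "nat \<Rightarrow> (nat \<Rightarrow> nat) \<Rightarrow> (nat \<Rightarrow> nat) set" where
  "mvp_fibre n \<pi> = {p \<in> MVP_PF n. mvp_outcome n p = \<pi>}"

definition dec_perm :: "nat \<Rightarrow> (nat \<Rightarrow> nat)" where
  "dec_perm n = (\<lambda>k. if k \<in> {1..n} then n + 1 - k else k)"

definition arc_diagrams :: "nat \<Rightarrow> (nat \<times> nat) set set" where
  "arc_diagrams n = {\<Delta>. \<forall>(j, i) \<in> \<Delta>. 1 \<le> j \<and> j < i \<and> i \<le> n}"

definition left_unique_diagrams :: "nat \<Rightarrow> (nat \<times> nat) set set" where
  "left_unique_diagrams n =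
     {\<Delta> \<in> arc_diagrams n. \<forall>i\<in>{1..n}. \<forall>j j'. (j, i) \<in> \<Delta> \<longrightarrow> (j', i) \<in> \<Delta> \<longrightarrow> j = j'}"

text \<open>Only meaningful on \<open>left_unique_diagrams n\<close>. The argument \<open>m\<close> stands for \<open>n + 1 - i\<close>.\<close>

definition Psi_Sub_PF :: "nat \<Rightarrow> (nat \<times> nat) set \<Rightarrow> (nat \<Rightarrow> nat)" where
  "Psi_Sub_PF n \<Delta> =
     (\<lambda>m\<in>{1..n}. let i = n + 1 - m in
        if \<exists>j. (j, i) \<in> \<Delta> then (THE j. (j, i) \<in> \<Delta>) else i)"

definition NonCross :: "nat \<Rightarrow> (nat \<times> nat) set set" where
  "NonCross n =
     {\<Delta> \<in> arc_diagrams n.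
        (\<forall>v\<in>{1..n}. \<forall>a\<in>\<Delta>. \<forall>b\<in>\<Delta>. v \<in> {fst a, snd a} \<and> v \<in> {fst b, snd b} \<longrightarrow> a = b) \<and>
        \<not> (\<exists>i j k l. i < j \<and> j < k \<and> k < l \<and> (i, k) \<in> \<Delta> \<and> (j, l) \<in> \<Delta>)}"

lemma mvp_outcome_permutes:
  assumes "p \<in> MVP_PF n"
  shows "mvp_outcome n p permutes {1..n}"
proof -
  let ?f = "mvp_outcome n p"
  have sub: "{1..n} \<subseteq> ?f ` {1..n}"
  proof
    fix i assume "i \<in> {1..n}"
    then obtain k where "k \<in> {1..n}" "mvp_street n p n k = Some i"
      using assms unfolding MVP_PF_def by blast
    then show "i \<in> ?f ` {1..n}"
      by (intro image_eqI[of _ _ k]) (auto simp: mvp_outcome_def)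
  qed
  have img: "?f ` {1..n} = {1..n}"
    using card_seteq[OF _ sub] card_image_le[of "{1..n}" ?f] by simp
  then have "bij_betw ?f {1..n} {1..n}"
    by (simp add: bij_betw_def eq_card_imp_inj_on)
  then show ?thesis
    by (rule bij_imp_permutes) (auto simp: mvp_outcome_def)
qed

lemma dec_perm_permutes: "dec_perm n permutes {1..n}"
proof (rule bij_imp_permutes)
  show "bij_betw (dec_perm n) {1..n} {1..n}"
    by (rule bij_betw_byWitness[where f' = "dec_perm n"]) (auto simp: dec_perm_def)
qed (auto simp: dec_perm_def)

lemma Psi_Sub_PF_eq_arc:
  assumes "\<Delta> \<in> left_unique_diagrams n" "(j, i) \<in> \<Delta>"
  shows "Psi_Sub_PF n \<Delta> (n + 1 - i) = j"
proof -
  have i: "i \<in> {1..n}"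
    using assms by (force simp: left_unique_diagrams_def arc_diagrams_def)
  have "(THE j. (j, i) \<in> \<Delta>) = j"
    using assms i by (intro the_equality) (auto simp: left_unique_diagrams_def)
  moreover have "n + 1 - (n + 1 - i) = i" "n + 1 - i \<in> {1..n}"
    using i by auto
  ultimately show ?thesis
    using assms(2) unfolding Psi_Sub_PF_def Let_def by (auto simp del: atLeastAtMost_iff)
qed

lemma Psi_Sub_PF_eq_no_arc:
  assumes "i \<in> {1..n}" "\<nexists>j. (j, i) \<in> \<Delta>"
  shows "Psi_Sub_PF n \<Delta> (n + 1 - i) = i"
proof -
  have "n + 1 - (n + 1 - i) = i" "n + 1 - i \<in> {1..n}"
    using assms(1) by auto
  then show ?thesis
    using assms(2) unfolding Psi_Sub_PF_def Let_def by (auto simp del: atLeastAtMost_iff)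
qed

lemma NonCross_subset_left_unique: "NonCross n \<subseteq> left_unique_diagrams n"
proof
  fix \<Delta> assume D: "\<Delta> \<in> NonCross n"
  then have "\<forall>v\<in>{1..n}. \<forall>a\<in>\<Delta>. \<forall>b\<in>\<Delta>. v \<in> {fst a, snd a} \<and> v \<in> {fst b, snd b} \<longrightarrow> a = b"
    unfolding NonCross_def by (elim CollectE conjE)
  note * = this[rule_format]
  have "j = j'" if "i \<in> {1..n}" "(j, i) \<in> \<Delta>" "(j', i) \<in> \<Delta>" for i j j'
    using *[OF that] by simp
  then show "\<Delta> \<in> left_unique_diagrams n"
    using D by (simp add: NonCross_def left_unique_diagrams_def)
qed

end

theory Submission
  imports Defs
begin

text \<open>
  In a process with outcome \<open>dec_n\<close>, car \<open>c\<close> ends in spot \<open>n + 1 - c\<close>, hence \<open>p c \<le> n + 1 - c\<close>.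
  After the first \<open>m\<close> cars, no later car prefers a spot beyond \<open>n - m\<close>, so a car in such a spot
  is already at its final position. A downward induction on \<open>m\<close> shows that
  the cars in the spots up to \<open>n - m\<close> are increasing from left to right. A car preferring a spot
  strictly before its final one can therefore not bump anyone: the bumped car would land to its right.
  So each car \<open>c\<close> sits in \<open>p c\<close> until car \<open>n + 1 - p c\<close> sends it directly to spot \<open>n + 1 - c\<close>.
  This makes the arcs \<open>(p c, n + 1 - c)\<close> a matching, and by monotonicity a non-crossing one.
  Conversely, the same description of the street holds for the preference of every non-crossing
  matching, since non-crossing says that the first free spot for the bumped car is the other end
  of its arc.
\<close>

section \<open>The parking process\<close>

lemma mvp_street_Suc_free:
  assumes "mvp_street n p m (p (Suc m)) = None"
  shows "mvp_street n p (Suc m) = (mvp_street n p m)(p (Suc m) \<mapsto> Suc m)"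
  using assms by (simp add: mvp_park_def)

lemma mvp_street_Suc_bump:
  assumes "mvp_street n p m (p (Suc m)) = Some c"
    and "p (Suc m) < k" "k \<le> n" "mvp_street n p m k = None"
    and "\<And>u. p (Suc m) < u \<Longrightarrow> u < k \<Longrightarrow> mvp_street n p m u \<noteq> None"
  shows "mvp_street n p (Suc m) = (mvp_street n p m)(p (Suc m) \<mapsto> Suc m, k \<mapsto> c)"
proof -
  have "(LEAST k. p (Suc m) < k \<and> k \<le> n \<and> mvp_street n p m k = None) = k"
    using assms(2-5) by (intro Least_equality) (blast, meson not_le)
  then show ?thesis
    using assms(1-4) by (auto simp: mvp_park_def)
qed

lemma mvp_street_Suc_stuck:
  assumes "mvp_street n p m (p (Suc m)) = Some c"
    and "\<nexists>k. p (Suc m) < k \<and> k \<le> n \<and> mvp_street n p m k = None"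
  shows "mvp_street n p (Suc m) = (mvp_street n p m)(p (Suc m) \<mapsto> Suc m)"
  using assms by (auto simp: mvp_park_def)

declare mvp_street.simps(2)[simp del]

text \<open>A free preferred spot and a bumped car that leaves the street produce the same update,
  so both fall under \<open>plain\<close>.\<close>

lemma mvp_street_Suc_cases:
  obtains (plain) "mvp_street n p (Suc m) = (mvp_street n p m)(p (Suc m) \<mapsto> Suc m)"
  | (bump) c k where "mvp_street n p m (p (Suc m)) = Some c"
      "p (Suc m) < k" "k \<le> n" "mvp_street n p m k = None"
      "\<And>u. p (Suc m) < u \<Longrightarrow> u < k \<Longrightarrow> mvp_street n p m u \<noteq> None"
      "mvp_street n p (Suc m) = (mvp_street n p m)(p (Suc m) \<mapsto> Suc m, k \<mapsto> c)"
proof (cases "mvp_street n p m (p (Suc m))")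
  case None
  then show ?thesis using mvp_street_Suc_free plain by blast
next
  case (Some c)
  let ?P = "\<lambda>k. p (Suc m) < k \<and> k \<le> n \<and> mvp_street n p m k = None"
  show ?thesis
  proof (cases "\<exists>k. ?P k")
    case True
    define k where "k = (LEAST k. ?P k)"
    have k: "?P k"
      using LeastI_ex[OF True] by (simp add: k_def)
    have *: "mvp_street n p m u \<noteq> None" if "p (Suc m) < u" "u < k" for u
      using not_less_Least[of u ?P] that k by (auto simp: k_def[symmetric])
    show ?thesis
      using k * Some by (intro bump[of c k] mvp_street_Suc_bump) auto
  next
    case False
    then show ?thesis using mvp_street_Suc_stuck Some plain by blast
  qed
qed

text \<open>Reads one parking step backwards, from an occupied spot to where its car came from; this
  is the case split for the inductions on the number of cars.\<close>

lemma mvp_street_SucE: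
  assumes "mvp_street n p (Suc m) v = Some c"
  obtains (new) "v = p (Suc m)" "c = Suc m"
  | (keep) "v \<noteq> p (Suc m)" "mvp_street n p m v = Some c"
  | (bumped) "mvp_street n p m (p (Suc m)) = Some c" "p (Suc m) < v"
      "mvp_street n p m v = None"
      "\<And>u. p (Suc m) < u \<Longrightarrow> u < v \<Longrightarrow> mvp_street n p m u \<noteq> None"
proof (cases "v = p (Suc m)")
  case True
  have "c = Suc m"
    using assms True by (cases rule: mvp_street_Suc_cases[of n p m]) auto
  with True show ?thesis by (rule new)
next
  case False
  show ?thesis
  proof (cases rule: mvp_street_Suc_cases[of n p m])
    case plain
    then have "mvp_street n p m v = Some c"
      using assms False by simp
    with False show ?thesis by (rule keep)
  next
    case (bump d k)
    show ?thesis
    proof (cases "v = k")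
      case True
      then have "d = c"
        using assms bump(6) by simp
      with True show ?thesis
        using bump(1-4) by (intro bumped bump(5)) simp_all
    next
      case ne: False
      then have "mvp_street n p m v = Some c"
        using assms False bump(6) by simp
      with False show ?thesis by (rule keep)
    qed
  qed
qed

lemma mvp_street_Suc_pref: "mvp_street n p (Suc m) (p (Suc m)) = Some (Suc m)"
  by (cases rule: mvp_street_Suc_cases[of n p m]) auto

lemma mvp_street_Suc_keep:
  "v \<noteq> p (Suc m) \<Longrightarrow> mvp_street n p m v = Some c \<Longrightarrow> mvp_street n p (Suc m) v = Some c"
  by (cases rule: mvp_street_Suc_cases[of n p m]) auto

lemma mvp_street_Suc_occupied:
  "mvp_street n p m v \<noteq> None \<Longrightarrow> mvp_street n p (Suc m) v \<noteq> None"
  by (cases rule: mvp_street_Suc_cases[of n p m]) auto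

text \<open>Every move of a car goes to the right, so it never stands before its preference.\<close>

lemma mvp_street_range:
  "mvp_street n p m v = Some c \<Longrightarrow> 1 \<le> c \<and> c \<le> m \<and> p c \<le> v"
proof (induction m arbitrary: v)
  case (Suc m)
  from Suc.prems show ?case
    by (cases rule: mvp_street_SucE) (use Suc.IH in force)+
qed simp

text \<open>The arriving car is not yet on the street and overwrites the spot of the car it bumps,
  so no step duplicates a car.\<close>

lemma mvp_street_inj:
  "mvp_street n p m v = Some c \<Longrightarrow> mvp_street n p m w = Some c \<Longrightarrow> v = w"
proof (induction m arbitrary: v w)
  case (Suc m)
  have new_car: "mvp_street n p m u \<noteq> Some (Suc m)" for u
    using mvp_street_range[of n p m u "Suc m"] by auto
  note v = Suc.prems(1) and w = Suc.prems(2)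
  from v show ?case
  proof (cases rule: mvp_street_SucE)
    case new
    from w show ?thesis
      by (cases rule: mvp_street_SucE) (use new new_car in auto)
  next
    case keep
    from w show ?thesis
    proof (cases rule: mvp_street_SucE)
      case new
      then show ?thesis using keep new_car by simp
    qed (use keep Suc.IH in blast)+
  next
    case bumped
    from w show ?thesis
    proof (cases rule: mvp_street_SucE)
      case new
      then show ?thesis using bumped new_car by simp
    next
      case keep
      then show ?thesis using bumped Suc.IH by blast
    next
      case w: bumped
      \<comment> \<open>Both spots are the first free one after \<open>p (Suc m)\<close>, hence
        equal.\<close>
      then show ?thesis using bumped by (metis linorder_neqE_nat)
    qed
  qed
qed simp

text \<open>A car that has left the street never returns. In the fibre this makes every arrived car
  present at all later times.\<close>

lemma mvp_street_present_earlier: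
  assumes "m \<le> m'" "c \<le> m" "\<exists>v. mvp_street n p m' v = Some c"
  shows "\<exists>v. mvp_street n p m v = Some c"
  using assms(1,3)
proof (induction m' rule: dec_induct)
  case (step k)
  then obtain v where "mvp_street n p (Suc k) v = Some c"
    by blast
  then have "\<exists>v. mvp_street n p k v = Some c"
    using assms(2) step.hyps by (cases rule: mvp_street_SucE) auto
  then show ?case
    by (rule step.IH)
qed

section \<open>The fibre over the decreasing permutation\<close>

locale dec_fibre =
  fixes n :: nat and p :: "nat \<Rightarrow> nat"
  assumes fibre: "p \<in> mvp_fibre n (dec_perm n)"
begin

abbreviation "S \<equiv> mvp_street n p"

lemma final_spot:
  assumes "c \<in> {1..n}"
  shows "S n (n + 1 - c) = Some c"
proof -
  obtain k where k: "k \<in> {1..n}" "S n k = Some c"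
    using assms fibre unfolding mvp_fibre_def MVP_PF_def by blast
  have "mvp_outcome n p k = dec_perm n k"
    using fibre by (simp add: mvp_fibre_def)
  then have "c = n + 1 - k"
    using k by (simp add: mvp_outcome_def dec_perm_def)
  then show ?thesis
    using k by simp
qed

lemma pref_in: "c \<in> {1..n} \<Longrightarrow> p c \<in> {1..n}"
  using fibre by (auto simp: mvp_fibre_def MVP_PF_def preferences_def)

lemma pref_le: "c \<in> {1..n} \<Longrightarrow> p c \<le> n + 1 - c"
  using mvp_street_range[OF final_spot] by blast

lemma present:
  assumes "1 \<le> c" "c \<le> m" "m \<le> n"
  obtains v where "S m v = Some c"
  using mvp_street_present_earlier[of m n c n p] final_spot[of c] assms by auto

lemma settled:
  assumes "m \<le> n" "S m v = Some c" "n < v + m"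
  shows "v = n + 1 - c"
proof -
  have "S m' v = Some c" if "m \<le> m'" "m' \<le> n" for m'
    using that
  proof (induction m' rule: dec_induct)
    case (step k)
    \<comment> \<open>\<open>pref_le\<close> gives
      \<open>p (Suc k) \<le> n - k \<le> n - m < v\<close>, so later cars do not disturb spot
      \<open>v\<close>.\<close>
    then have "p (Suc k) < v"
      using pref_le[of "Suc k"] assms(3) by auto
    then show ?case
      using step by (intro mvp_street_Suc_keep) auto
  qed (rule assms(2))
  then have "S n v = Some c"
    using assms(1) by simp
  moreover have "c \<in> {1..n}"
    using mvp_street_range[OF assms(2)] assms(1) by simp
  ultimately show ?thesis
    using final_spot mvp_street_inj by blast
qed

text \<open>Spot \<open>n - m\<close> is the final spot of car \<open>Suc m\<close>. After
  \<open>Suc m\<close> cars any occupant there is settled, so it is car \<open>Suc m\<close> itself,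
  which has just parked at its preference.\<close>

lemma occupied_own_spot:
  assumes "Suc m \<le> n" "S (Suc m) (n - m) \<noteq> None"
  shows "p (Suc m) = n - m"
proof -
  obtain c where c: "S (Suc m) (n - m) = Some c"
    using assms(2) by auto
  then have "n - m = n + 1 - c"
    using settled[OF assms(1) c] assms(1) by simp
  moreover have "c \<le> Suc m"
    using mvp_street_range[OF c] by simp
  ultimately have "c = Suc m"
    using assms(1) by linarith
  then show ?thesis
    using mvp_street_inj[OF c, of "p (Suc m)"] mvp_street_Suc_pref[of n p m] by simp
qed

text \<open>By \<open>occupied_own_spot\<close>, spot \<open>n - m\<close> is still empty after the
  step. It was thus free for the bumped car and yet not taken, so an earlier free spot was.\<close>

lemma bumped_below:
  assumes "Suc m \<le> n" "p (Suc m) < n - m" "S m (p (Suc m)) = Some c"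
  obtains u where "p (Suc m) < u" "u < n - m" "S (Suc m) u = Some c"
proof -
  have c: "1 \<le> c" "c \<le> m"
    using mvp_street_range[OF assms(3)] by auto
  then obtain v where v: "S (Suc m) v = Some c"
    using present[of c "Suc m"] assms(1) by auto
  have no: "S (Suc m) (n - m) = None"
    using occupied_own_spot[OF assms(1)] assms(2) by (metis less_irrefl)
  from v show ?thesis
  proof (cases rule: mvp_street_SucE)
    case new
    then show ?thesis using c by simp
  next
    case keep
    then show ?thesis using mvp_street_inj assms(3) by blast
  next
    case bumped
    have "\<not> n - m < v"
      using bumped(4)[of "n - m"] assms(2) no mvp_street_Suc_occupied by blast
    moreover have "v \<noteq> n - m"
      using no v by auto
    ultimately show ?thesis
      using that[of v] bumped v by auto
  qed
qed

lemma cars_increasing: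
  assumes "m \<le> n"
  shows "a < b \<Longrightarrow> b \<le> n - m \<Longrightarrow> S m a = Some \<alpha> \<Longrightarrow> S m b = Some \<beta> \<Longrightarrow> \<alpha> < \<beta>"
  using assms
proof (induction m arbitrary: a b \<alpha> \<beta> rule: inc_induct)
  \<comment> \<open>Vacuous: \<open>b \<le> n - n\<close> leaves no room for
    \<open>a < b\<close>.\<close>
  case base
  then have "n + 1 - \<beta> = 0"
    using settled[of n b \<beta>] by simp
  then show ?case
    using mvp_street_range[OF base(4)] by simp
next
  case (step m)
  have m: "Suc m \<le> n" using step.hyps by simp
  have cars: "\<alpha> \<le> m" "\<beta> \<le> m" "1 \<le> \<alpha>" "1 \<le> \<beta>"
    using mvp_street_range step.prems(3,4) by blast+
  have neq: "\<alpha> \<noteq> \<beta>"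
    using mvp_street_inj step.prems(1,3,4) by blast
  show ?case
  proof (rule ccontr)
    assume "\<not> \<alpha> < \<beta>"
    with neq have less: "\<beta> < \<alpha>" by simp
    show False
    proof (cases "b = n - m")
      case True
      \<comment> \<open>Here car \<open>Suc m\<close> bumps \<open>\<beta>\<close> to its final spot
        \<open>n + 1 - \<beta>\<close>, passing over \<open>n + 1 - \<alpha>\<close>. That spot must
        be occupied, hence by \<open>\<alpha>\<close>, which puts \<open>a\<close> to the right of
        \<open>b\<close>.\<close>
      have r: "p (Suc m) = n - m"
        using occupied_own_spot[OF m] mvp_street_Suc_occupied step.prems(4) True by blast
      obtain v where v: "S (Suc m) v = Some \<beta>"
        using present[of \<beta> "Suc m"] cars m by auto
      from v show False
      proof (cases rule: mvp_street_SucE)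
        case new
        then show ?thesis using cars by simp
      next
        case keep
        then show ?thesis using mvp_street_inj step.prems(4) r True by metis
      next
        case bumped
        have "v = n + 1 - \<beta>"
          using settled[OF m v] bumped(2) r m by simp
        then have "S m (n + 1 - \<alpha>) \<noteq> None"
          using bumped(4)[of "n + 1 - \<alpha>"] r less cars m by simp
        then obtain d where d: "S m (n + 1 - \<alpha>) = Some d" by auto
        have "n + 1 - \<alpha> = n + 1 - d"
          by (rule settled[OF _ d]) (use m cars in auto)
        moreover have "d \<le> m"
          using mvp_street_range[OF d] by simp
        ultimately have "d = \<alpha>"
          using cars m by linarith
        then have "a = n + 1 - \<alpha>"
          using mvp_street_inj[OF d] step.prems(3) by auto
        then show ?thesis
          using step.prems(1,2) cars m by simp
      qed
    next
      case False
      then have b: "b < n - m" using step.prems(2) by simp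
      \<comment> \<open>In each case the street after \<open>Suc m\<close> cars has two cars
        contradicting the induction hypothesis: \<open>Suc m\<close> before \<open>\<beta>\<close>
        if \<open>\<alpha>\<close> is bumped, and otherwise \<open>\<alpha>\<close> before
        \<open>\<beta>\<close>, where a bumped \<open>\<beta>\<close> has only moved further
        right.\<close>
      consider "p (Suc m) = a" | "p (Suc m) = b" | "p (Suc m) \<noteq> a" "p (Suc m) \<noteq> b" by blast
      then show False
      proof cases
        case 1
        have "S (Suc m) b = Some \<beta>" "S (Suc m) a = Some (Suc m)"
          using mvp_street_Suc_keep[of b p m n] mvp_street_Suc_pref[of n p m] step.prems(1,4) 1
          by auto
        then have "Suc m < \<beta>"
          using step.IH[of a b "Suc m" \<beta>] step.prems(1) b m by simp
        then show ?thesis using cars by simp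
      next
        case 2
        obtain u where u: "b < u" "u < n - m" "S (Suc m) u = Some \<beta>"
          using bumped_below[OF m, of \<beta>] 2 b step.prems(4) by auto
        have "S (Suc m) a = Some \<alpha>"
          using mvp_street_Suc_keep[of a p m n] step.prems(1,3) 2 by auto
        then show ?thesis
          using step.IH[of a u \<alpha> \<beta>] u step.prems(1) less m by linarith
      next
        case 3
        then have "S (Suc m) a = Some \<alpha>" "S (Suc m) b = Some \<beta>"
          using mvp_street_Suc_keep[of _ p m n] step.prems(3,4) by auto
        then show ?thesis
          using step.IH[of a b \<alpha> \<beta>] step.prems(1) b less m by linarith
      qed
    qed
  qed
qed

lemma low_pref_free:
  assumes "Suc m \<le> n" "p (Suc m) < n - m"
  shows "S m (p (Suc m)) = None"
proof (rule ccontr)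
  assume "S m (p (Suc m)) \<noteq> None"
  then obtain c where c: "S m (p (Suc m)) = Some c" by auto
  obtain u where "p (Suc m) < u" "u < n - m" "S (Suc m) u = Some c"
    using bumped_below[OF assms c] .
  then have "Suc m < c"
    using cars_increasing[OF assms(1)] mvp_street_Suc_pref[of n p m] by simp
  then show False
    using mvp_street_range[OF c] by simp
qed

text \<open>The car that evicts \<open>c\<close> is \<open>n + 1 - p c\<close>, and it has arrived
  exactly when \<open>p c > n - m\<close>; hence the threshold.\<close>

lemma position:
  "m \<le> n \<Longrightarrow> S m v = Some c \<Longrightarrow> v = (if p c \<le> n - m then p c else n + 1 - c)"
proof (induction m arbitrary: v)
  case (Suc m)
  note m = \<open>Suc m \<le> n\<close>
  have settled': "v = n + 1 - c" if "n - m \<le> v"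
    using settled[OF m Suc.prems(2)] that m by simp
  have c: "c \<le> Suc m" "p c \<le> v"
    using mvp_street_range[OF Suc.prems(2)] by auto
  from Suc.prems(2) show ?case
  proof (cases rule: mvp_street_SucE)
    case new
    then show ?thesis using settled' by auto
  next
    case keep
    \<comment> \<open>Passing to \<open>Suc m\<close> changes the branch only for
      \<open>p c = n - m\<close>; then \<open>v = n - m\<close>, and \<open>settled'\<close>
      supplies the new form.\<close>
    have "v = (if p c \<le> n - m then p c else n + 1 - c)"
      using Suc.IH keep(2) m by simp
    moreover have "c \<le> m"
      using mvp_street_range[OF keep(2)] by simp
    ultimately show ?thesis
      using settled' c m by (auto split: if_splits)
  next
    case bumped
    have c': "c \<le> m" using mvp_street_range[OF bumped(1)] by simp
    have "\<not> p (Suc m) < n - m"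
      using low_pref_free[OF m] bumped(1) by auto
    then have r: "p (Suc m) = n - m"
      using pref_le[of "Suc m"] m by simp
    have "n - m = (if p c \<le> n - m then p c else n + 1 - c)"
      using Suc.IH[of "p (Suc m)"] bumped(1) m r by simp
    \<comment> \<open>The other branch would make \<open>n - m\<close> the final spot of
      \<open>c\<close>, impossible for \<open>c \<le> m\<close>.\<close>
    then have "p c = n - m"
      using c' m by (auto split: if_splits)
    then show ?thesis
      using settled' bumped(2) r m by auto
  qed
qed simp

lemma street_at_position:
  assumes "1 \<le> c" "c \<le> m" "m \<le> n"
  shows "S m (if p c \<le> n - m then p c else n + 1 - c) = Some c"
proof -
  obtain v where v: "S m v = Some c"
    using present[OF assms] .
  then show ?thesis
    using position[OF assms(3) v] by simp
qed

end

section \<open>Arcs of a preference\<close>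

text \<open>The candidate inverse of \<open>Psi_Sub_PF\<close>: an arc joins the preference of a car
  to its final spot. Cars preferring their final spot give no arc, in line with the default value of
  \<open>Psi_Sub_PF\<close>.\<close>

definition pref_arcs :: "nat \<Rightarrow> (nat \<Rightarrow> nat) \<Rightarrow> (nat \<times> nat) set" where
  "pref_arcs n p = {(p c, n + 1 - c) | c. c \<in> {1..n} \<and> p c < n + 1 - c}"

lemma (in dec_fibre) pref_arcs_NonCross: "pref_arcs n p \<in> NonCross n"
proof -
  have at: "S m (p c) = Some c" if "1 \<le> c" "c \<le> m" "m \<le> n" "p c \<le> n - m" for c m
    using street_at_position[OF that(1-3)] that(4) by simp
  \<comment> \<open>At time \<open>d\<close> both cars would stand in the spot
    \<open>p d\<close>.\<close>
  have openers: "\<not> c < d" if "c \<in> {1..n}" "d \<in> {1..n}" "p c = p d" "p d < n + 1 - d" for c d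
  proof -
    have "p d \<le> n - d" using that(4) by linarith
    then show ?thesis
      using at[of c d] at[of d d] that(1-3) by auto
  qed
  \<comment> \<open>Otherwise \<open>c\<close> occupies the final spot of \<open>d\<close> just
    before \<open>d\<close> arrives; the spot stays occupied, so \<open>occupied_own_spot\<close>
    makes \<open>d\<close> prefer it, and \<open>d\<close> would have no arc.\<close>
  have mixed: "p c \<noteq> n + 1 - d"
    if c: "c \<in> {1..n}" "d \<in> {1..n}" "p c < n + 1 - c" "p d < n + 1 - d" for c d
  proof
    assume eq: "p c = n + 1 - d"
    then have cd: "c \<le> d - 1" "p c = n - (d - 1)"
      using c by auto
    then have "S (d - 1) (n - (d - 1)) = Some c"
      using at[of c "d - 1"] c by auto
    then have "S d (n - (d - 1)) \<noteq> None"
      using mvp_street_Suc_occupied[of n p "d - 1" "n - (d - 1)"] c by auto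
    then show False
      using occupied_own_spot[of "d - 1"] c cd eq by auto
  qed
  have "a = b"
    if ab: "a \<in> pref_arcs n p" "b \<in> pref_arcs n p" "v \<in> {fst a, snd a}" "v \<in> {fst b, snd b}" for a b v
  proof -
    obtain c d where *: "a = (p c, n + 1 - c)" "c \<in> {1..n}" "p c < n + 1 - c"
        "b = (p d, n + 1 - d)" "d \<in> {1..n}" "p d < n + 1 - d"
      using ab(1,2) by (auto simp: pref_arcs_def)
    then have "p c = p d \<or> n + 1 - c = n + 1 - d"
      using ab(3,4) mixed[of c d] mixed[of d c] by auto
    then have "c = d"
    proof
      assume "p c = p d"
      then show ?thesis
        using openers[of c d] openers[of d c] *(2,3,5,6) by (metis linorder_neqE_nat)
    qed (use * in auto)
    then show ?thesis using * by simp
  qed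
  moreover have False
    if ijkl: "i < j" "j < k" "k < l" "(i, k) \<in> pref_arcs n p" "(j, l) \<in> pref_arcs n p" for i j k l
  proof -
    obtain c d where *: "i = p c" "k = n + 1 - c" "c \<in> {1..n}"
        "j = p d" "l = n + 1 - d" "d \<in> {1..n}"
      using ijkl(4,5) by (auto simp: pref_arcs_def)
    \<comment> \<open>At time \<open>c\<close> both cars of the crossing arcs still stand at their
      preferences, in the order forbidden by \<open>cars_increasing\<close>.\<close>
    have low: "p c \<le> n - c" "p d \<le> n - c"
      using * ijkl(1,2) by linarith+
    have "d < c"
      using * ijkl(3) by linarith
    have "S c (p c) = Some c" "S c (p d) = Some d"
      using at[of c c] at[of d c] low * \<open>d < c\<close> by auto
    then have "c < d"
      using cars_increasing[of c "p c" "p d" c d] low * ijkl(1) by auto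
    then show False using \<open>d < c\<close> by simp
  qed
  moreover have "pref_arcs n p \<in> arc_diagrams n"
    using pref_in by (auto simp: pref_arcs_def arc_diagrams_def)
  ultimately show ?thesis
    unfolding NonCross_def by blast
qed

section \<open>Passing between preferences and arc diagrams\<close>

lemma Psi_Sub_PF_preferences:
  assumes "\<Delta> \<in> left_unique_diagrams n"
  shows "Psi_Sub_PF n \<Delta> \<in> preferences n"
    and "c \<in> {1..n} \<Longrightarrow> Psi_Sub_PF n \<Delta> c \<le> n + 1 - c"
proof -
  have *: "Psi_Sub_PF n \<Delta> c \<in> {1..n} \<and> Psi_Sub_PF n \<Delta> c \<le> n + 1 - c" if c: "c \<in> {1..n}" for c
  proof (cases "\<exists>j. (j, n + 1 - c) \<in> \<Delta>")
    case True
    then obtain j where j: "(j, n + 1 - c) \<in> \<Delta>" by blast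
    then have "1 \<le> j" "j < n + 1 - c"
      using assms by (auto simp: left_unique_diagrams_def arc_diagrams_def)
    then show ?thesis
      using Psi_Sub_PF_eq_arc[OF assms j] c by auto
  next
    case False
    moreover have "n + 1 - c \<in> {1..n}" "n + 1 - (n + 1 - c) = c"
      using c by auto
    ultimately have "Psi_Sub_PF n \<Delta> c = n + 1 - c"
      using Psi_Sub_PF_eq_no_arc[of "n + 1 - c" n \<Delta>] by metis
    then show ?thesis
      using c by auto
  qed
  then show "c \<in> {1..n} \<Longrightarrow> Psi_Sub_PF n \<Delta> c \<le> n + 1 - c" by blast
  have "Psi_Sub_PF n \<Delta> \<in> extensional {1..n}"
    by (simp add: Psi_Sub_PF_def)
  with * show "Psi_Sub_PF n \<Delta> \<in> preferences n"
    by (auto simp: preferences_def PiE_def)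
qed

lemma pref_arcs_Psi_Sub_PF:
  assumes "\<Delta> \<in> left_unique_diagrams n"
  shows "pref_arcs n (Psi_Sub_PF n \<Delta>) = \<Delta>"
proof (intro set_eqI iffI)
  fix a assume "a \<in> pref_arcs n (Psi_Sub_PF n \<Delta>)"
  then obtain c where c: "a = (Psi_Sub_PF n \<Delta> c, n + 1 - c)" "c \<in> {1..n}"
      "Psi_Sub_PF n \<Delta> c < n + 1 - c"
    by (auto simp: pref_arcs_def)
  then obtain j where j: "(j, n + 1 - c) \<in> \<Delta>"
    using Psi_Sub_PF_eq_no_arc[of "n + 1 - c" n \<Delta>] by force
  then show "a \<in> \<Delta>"
    using Psi_Sub_PF_eq_arc[OF assms j] c by auto
next
  fix a assume a: "a \<in> \<Delta>"
  obtain j i where ji: "a = (j, i)" by force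
  then have "j < i" "i \<in> {1..n}"
    using a assms by (auto simp: left_unique_diagrams_def arc_diagrams_def)
  then show "a \<in> pref_arcs n (Psi_Sub_PF n \<Delta>)"
    using Psi_Sub_PF_eq_arc[OF assms] a ji
    by (auto simp: pref_arcs_def intro!: exI[of _ "n + 1 - i"])
qed

text \<open>By the bound on \<open>p\<close>, a car without an arc prefers \<open>n + 1 - c\<close>,
  which is the default value of \<open>Psi_Sub_PF\<close>.\<close>

lemma Psi_Sub_PF_pref_arcs:
  assumes "p \<in> preferences n" "\<And>c. c \<in> {1..n} \<Longrightarrow> p c \<le> n + 1 - c"
    and "pref_arcs n p \<in> left_unique_diagrams n"
  shows "Psi_Sub_PF n (pref_arcs n p) = p"
proof (rule PiE_ext[of _ "{1..n}" "\<lambda>_. {1..n}"])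
  show "Psi_Sub_PF n (pref_arcs n p) \<in> {1..n} \<rightarrow>\<^sub>E {1..n}" "p \<in> {1..n} \<rightarrow>\<^sub>E {1..n}"
    using Psi_Sub_PF_preferences(1)[OF assms(3)] assms(1) by (auto simp: preferences_def)
  fix c assume c: "c \<in> {1..n}"
  then have cc: "n + 1 - (n + 1 - c) = c" by auto
  show "Psi_Sub_PF n (pref_arcs n p) c = p c"
  proof (cases "p c < n + 1 - c")
    case True
    then have "(p c, n + 1 - c) \<in> pref_arcs n p"
      using c by (auto simp: pref_arcs_def)
    from Psi_Sub_PF_eq_arc[OF assms(3) this] show ?thesis
      unfolding cc .
  next
    case False
    have "\<nexists>j. (j, n + 1 - c) \<in> pref_arcs n p"
    proof
      assume "\<exists>j. (j, n + 1 - c) \<in> pref_arcs n p"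
      then obtain d where d: "d \<in> {1..n}" "n + 1 - c = n + 1 - d" "p d < n + 1 - d"
        by (auto simp: pref_arcs_def)
      then have "c = d" using c by auto
      with d False show False by simp
    qed
    moreover have "n + 1 - c \<in> {1..n}"
      using c by auto
    ultimately have "Psi_Sub_PF n (pref_arcs n p) c = n + 1 - c"
      using Psi_Sub_PF_eq_no_arc[of "n + 1 - c" n "pref_arcs n p"] cc by metis
    then show ?thesis
      using False assms(2)[OF c] by simp
  qed
qed

section \<open>Parking along a non-crossing matching\<close>

lemma NonCross_in_fibre:
  assumes pref: "p \<in> preferences n" and le: "\<And>c. c \<in> {1..n} \<Longrightarrow> p c \<le> n + 1 - c"
    and NC: "pref_arcs n p \<in> NonCross n"
  shows "p \<in> mvp_fibre n (dec_perm n)"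
proof -
  let ?S = "mvp_street n p"
  \<comment> \<open>The predicted spot of car \<open>c\<close> after \<open>m\<close> cars, by the
    formula of \<open>position\<close>.\<close>
  define pos where "pos = (\<lambda>m c. if p c \<le> n - m then p c else n + 1 - c)"
  have in1: "p c \<in> {1..n}" if "c \<in> {1..n}" for c
    using pref that by (auto simp: preferences_def)
  have arc: "(p c, n + 1 - c) \<in> pref_arcs n p" if "c \<in> {1..n}" "p c < n + 1 - c" for c
    using that by (auto simp: pref_arcs_def)
  have "\<forall>v\<in>{1..n}. \<forall>a\<in>pref_arcs n p. \<forall>b\<in>pref_arcs n p.
      v \<in> {fst a, snd a} \<and> v \<in> {fst b, snd b} \<longrightarrow> a = b"
    using NC unfolding NonCross_def by (elim CollectE conjE)
  note match = this[rule_format]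
  have openers: "c = d"
    if "c \<in> {1..n}" "d \<in> {1..n}" "p c = p d" "p c < n + 1 - c" "p d < n + 1 - d" for c d
    using match[OF in1[of c] arc[of c] arc[of d]] that by auto
  have mixed: "p c \<noteq> n + 1 - d"
    if "c \<in> {1..n}" "d \<in> {1..n}" "p c < n + 1 - c" "p d < n + 1 - d" for c d
    using match[OF in1[of c] arc[of c] arc[of d]] that by auto
  have nocross: "\<not> (p c < p d \<and> p d < n + 1 - c \<and> d < c)"
    if "c \<in> {1..n}" "d \<in> {1..n}" for c d
  proof
    assume *: "p c < p d \<and> p d < n + 1 - c \<and> d < c"
    then have "n + 1 - c < n + 1 - d" using that by auto
    then have "(p c, n + 1 - c) \<in> pref_arcs n p" "(p d, n + 1 - d) \<in> pref_arcs n p"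
      using * that by (intro arc; simp)+
    with * \<open>n + 1 - c < n + 1 - d\<close> show False
      using NC unfolding NonCross_def by blast
  qed
  \<comment> \<open>The equivalence also determines the empty spots, which are needed to locate
    where a bumped car lands.\<close>
  have street: "?S m v = Some c \<longleftrightarrow> 1 \<le> c \<and> c \<le> m \<and> v = pos m c" if "m \<le> n" for m v c
    using that
  proof (induction m arbitrary: v c)
    case (Suc m)
    then have IH: "?S m v = Some c \<longleftrightarrow> 1 \<le> c \<and> c \<le> m \<and> v = pos m c" for v c
      by simp
    have m: "Suc m \<le> n" by fact
    have r: "p (Suc m) \<le> n - m" using le[of "Suc m"] m by simp
    have car: "c \<in> {1..n}" "n - m < n + 1 - c" if "1 \<le> c" "c \<le> m" for c
      using that m by auto
    have new_car: "?S m v \<noteq> Some (Suc m)" for v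
      using IH by simp
    have new: "pos (Suc m) (Suc m) = p (Suc m)"
      using r m by (auto simp: pos_def)
    have keep: "pos (Suc m) c = pos m c" if "p c \<noteq> n - m" for c
      using that by (auto simp: pos_def)
    show ?case
    proof (cases "?S m (p (Suc m))")
      case None
      have free: "pos m c \<noteq> p (Suc m)" if "1 \<le> c" "c \<le> m" for c
        using IH[of "pos m c" c] None that by (metis option.distinct(1))
      \<comment> \<open>Such a \<open>c\<close> would stand in \<open>n - m\<close>, so car
        \<open>Suc m\<close> would prefer an earlier spot, and its arc would end at
        \<open>n - m\<close>, where the arc of \<open>c\<close> starts.\<close>
      have stay: "p c \<noteq> n - m" if c: "1 \<le> c" "c \<le> m" for c
      proof
        assume eq: "p c = n - m"
        then have "p (Suc m) < n - m"
          using free[OF c] r by (simp add: pos_def)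
        then show False
          using mixed[of c "Suc m"] eq car[OF c] m by auto
      qed
      show ?thesis
      proof (cases "c = Suc m")
        case True
        then show ?thesis
          using mvp_street_Suc_free[of n p m, OF None] new new_car[of v] by auto
      next
        case False
        then have "?S (Suc m) v = Some c \<longleftrightarrow> v \<noteq> p (Suc m) \<and> ?S m v = Some c"
          using mvp_street_Suc_free[of n p m, OF None] by auto
        then show ?thesis
          using False IH[of v c] free[of c] keep[OF stay, of c] by (metis le_Suc_eq)
      qed
    next
      case (Some d)
      then have d: "1 \<le> d" "d \<le> m" "p (Suc m) = pos m d"
        using IH by blast+
      note dn = car[OF d(1,2)]
      have pd: "p d = p (Suc m)"
        using d(3) r dn by (auto simp: pos_def split: if_splits)
      \<comment> \<open>Car \<open>d\<close> has an arc starting at \<open>p (Suc m)\<close>. As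
        arcs share no vertex, car \<open>Suc m\<close> has none, so it prefers its final
        spot.\<close>
      have top: "p (Suc m) = n - m"
      proof (rule ccontr)
        assume "p (Suc m) \<noteq> n - m"
        then have "Suc m = d"
          using openers[of "Suc m" d] pd dn m r by auto
        then show False using d(2) by simp
      qed
      have other: "p c \<noteq> n - m" if "1 \<le> c" "c \<le> m" "c \<noteq> d" for c
        using openers[of c d] car[OF that(1,2)] that(3) pd top dn by auto
      have elsewhere: "pos m c \<noteq> n + 1 - d" if "1 \<le> c" "c \<le> m" for c
        using car[OF that] dn pd top by (cases "c = d") (auto simp: pos_def)
      have empty: "?S m (n + 1 - d) = None"
        using IH elsewhere by (metis option.exhaust)
      \<comment> \<open>Let \<open>e\<close> be the car with final spot \<open>u\<close>. If
        \<open>u\<close> were empty, \<open>e\<close> would still be at \<open>p e < p d\<close>,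
        and its arc to \<open>u\<close> would cross the arc from \<open>p d\<close> to
        \<open>n + 1 - d\<close>.\<close>
      have between: "?S m u \<noteq> None" if u: "p (Suc m) < u" "u < n + 1 - d" for u
      proof
        assume none: "?S m u = None"
        define e where "e = n + 1 - u"
        have e: "1 \<le> e" "e \<le> m" "u = n + 1 - e" "d < e"
          using u top m by (auto simp: e_def)
        have "u \<noteq> pos m e"
          using IH[of u e] none e by (metis option.distinct(1))
        then have "p e \<le> n - m"
          using e(3) by (auto simp: pos_def split: if_splits)
        then have "p e < p d"
          using other[of e] e pd top by simp
        then show False
          using nocross[of e d] car[OF e(1,2)] dn(1) e(3,4) u(1) pd by auto
      qed
      have S: "?S (Suc m) = (?S m)(p (Suc m) \<mapsto> Suc m, n + 1 - d \<mapsto> d)"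
        by (rule mvp_street_Suc_bump[of n p m d "n + 1 - d", OF Some _ _ empty between])
          (use top dn in auto)
      have pos_d: "pos (Suc m) d = n + 1 - d"
        using pd top m by (auto simp: pos_def)
      have ne: "n + 1 - d \<noteq> p (Suc m)"
        using dn top by simp
      consider "c = Suc m" | "c = d" | "c \<noteq> Suc m" "c \<noteq> d" by blast
      then show ?thesis
      proof cases
        case 1
        then show ?thesis
          using S ne new new_car[of v] d(2) by auto
      next
        case 2
        have "?S m v = Some d \<longleftrightarrow> v = p (Suc m)"
          using IH[of v d] d by auto
        then show ?thesis
          using 2 S ne pos_d d(1,2) by auto
      next
        case 3
        then have "?S (Suc m) v = Some c \<longleftrightarrow>
            v \<noteq> p (Suc m) \<and> v \<noteq> n + 1 - d \<and> ?S m v = Some c"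
          using S by auto
        moreover have "pos m c \<noteq> p (Suc m)" if "1 \<le> c" "c \<le> m"
          using other[OF that 3(2)] car[OF that] top by (auto simp: pos_def)
        ultimately show ?thesis
          using 3 IH[of v c] elsewhere[of c] keep[OF other, of c] by (metis le_Suc_eq)
      qed
    qed
  qed auto
  \<comment> \<open>At \<open>m = n\<close> the threshold \<open>n - m\<close> is 0, below every
    preference.\<close>
  have final: "?S n (n + 1 - c) = Some c" if "c \<in> {1..n}" for c
    using street[of n "n + 1 - c" c] in1[OF that] that by (auto simp: pos_def)
  have "p \<in> MVP_PF n"
    unfolding MVP_PF_def
  proof (intro CollectI conjI ballI pref)
    fix c assume "c \<in> {1..n}"
    then show "\<exists>k\<in>{1..n}. ?S n k = Some c"
      using final[of c] by (intro bexI[of _ "n + 1 - c"]) auto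
  qed
  moreover have "mvp_outcome n p = dec_perm n"
  proof
    fix k show "mvp_outcome n p k = dec_perm n k"
    proof (cases "k \<in> {1..n}")
      case True
      then have "n + 1 - (n + 1 - k) = k" "n + 1 - k \<in> {1..n}" by auto
      then have "?S n k = Some (n + 1 - k)"
        using final[of "n + 1 - k"] by simp
      then show ?thesis
        by (simp add: mvp_outcome_def dec_perm_def)
    qed (auto simp: mvp_outcome_def dec_perm_def)
  qed
  ultimately show ?thesis
    by (simp add: mvp_fibre_def)
qed

theorem theorem3p6:
  fixes n :: nat
  assumes "n \<ge> 1"
  shows "bij_betw (Psi_Sub_PF n) (NonCross n) (mvp_fibre n (dec_perm n))"
proof (rule bij_betw_byWitness[where f' = "pref_arcs n"])
  show "\<forall>\<Delta>\<in>NonCross n. pref_arcs n (Psi_Sub_PF n \<Delta>) = \<Delta>"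
    using NonCross_subset_left_unique pref_arcs_Psi_Sub_PF by blast
  show "pref_arcs n ` mvp_fibre n (dec_perm n) \<subseteq> NonCross n"
    using dec_fibre.pref_arcs_NonCross[OF dec_fibre.intro] by blast
  show "\<forall>p\<in>mvp_fibre n (dec_perm n). Psi_Sub_PF n (pref_arcs n p) = p"
  proof
    fix p assume p: "p \<in> mvp_fibre n (dec_perm n)"
    interpret dec_fibre n p using p by (rule dec_fibre.intro)
    show "Psi_Sub_PF n (pref_arcs n p) = p"
      using p pref_le pref_arcs_NonCross NonCross_subset_left_unique
      by (intro Psi_Sub_PF_pref_arcs) (auto simp: mvp_fibre_def MVP_PF_def)
  qed
  show "Psi_Sub_PF n ` NonCross n \<subseteq> mvp_fibre n (dec_perm n)"
  proof (rule image_subsetI)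
    fix \<Delta> assume D: "\<Delta> \<in> NonCross n"
    then have L: "\<Delta> \<in> left_unique_diagrams n"
      using NonCross_subset_left_unique by blast
    \<comment> \<open>The arcs of this preference are \<open>\<Delta>\<close> again, so
      \<open>D\<close> is the non-crossing condition that \<open>NonCross_in_fibre\<close> asks
      for.\<close>
    show "Psi_Sub_PF n \<Delta> \<in> mvp_fibre n (dec_perm n)"
      using Psi_Sub_PF_preferences[OF L] pref_arcs_Psi_Sub_PF[OF L] D
      by (intro NonCross_in_fibre) auto
  qed
qed

end
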